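(* Let $\mathcal A_q=\mathcal A_q(\underline x=(X_1,\dots,X_r),B,L,G)$ be a graded quantum cluster algebra. Let $\tilde{\underline x}=(\tilde X_1,\dots,\tilde X_r)$ be defined by $\tilde X_i=q^{G_i/2}X_i$. Then there is an isomorphism of graded quantum cluster algebras between $\tilde{\mathcal A}_q=\mathcal A_q(\tilde{\underline x},B,L,G)$ and $\mathcal A_q=\mathcal A_q(\underline x,B,L,G)$.
   Context: $\mathbb{K}=\mathbb{Q}(q^{1/2})$. A quantum seed $(\underline{x},B,L)$ of cardinality $r$, with a fixed subset of $\{1,\dots,r\}$ of mutable indices (the others are frozen), consists of: a skew-symmetric integer matrix $L=(l_{ij})$; a tuple $\underline{x}=(X_1,\dots,X_r)$ generating, as a skew-field over $\mathbb{K}$, the skew-field of fractions $\mathcal F$ of the quantum torus with generators $X_i^{\pm1}$ and relations $X_iX_j=q^{l_{ij}}X_jX_i$; and a skew-symmetric integer $r\times r$ matrix $B=(b_{ij})$ with $b_{ij}=0$ if $i,j$ are both frozen, compatible with $L$: for some positive integer $d$, $\sum_k b_{ki}l_{kj}=d\delta_{ij}$ for all mutable $i$ and all $j$. For $\underline a\in\mathbb{Z}^r$ put $M(\underline a)=q^{\frac12\sum_{i<j}a_ia_jl_{ji}}X_1^{a_1}\cdots X_r^{a_r}$. For mutable $k$ put $\underline b_k^+=-\underline e_k+\sum_{b_{ik}>0}b_{ik}\underline e_i$, $\underline b_k^-=-\underline e_k-\sum_{b_{ik}<0}b_{ik}\underline e_i$. Mutation in direction $k$ replaces $X_k$ by $X_k'=M(\underline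 b_k^+)+M(\underline b_k^-)$, leaves the other $X_i$ unchanged, and replaces $B,L$ by $EBE^T$ (entries with both indices frozen reset to $0$) and $E^TLE$, where $E_{rs}=\delta_{rs}$ if $s\ne k$, $E_{kk}=-1$, $E_{rk}=\max(0,-b_{rk})$ if $r\neq k$. The quantum cluster variables are all entries (including frozen ones) of all seeds obtained from the initial one by iterated mutation; the quantum cluster algebra $\mathcal A_q(\underline x,B,L)$ is the $\mathbb{K}$-subalgebra of $\mathcal F$ they generate. A graded quantum seed is $(\underline x,B,L,G)$ where $(\underline x,B,L)$ is a quantum seed and $G\in\mathbb{Z}^r$ satisfies $B_iG=0$ for every mutable $i$ ($B_i$ the $i$th row of $B$); one sets $\deg X_i=G_i$, and $\mathcal A_q(\underline x,B,L,G)$ denotes the associated (graded) quantum cluster algebra. Gradings mutate along with seeds: under mutation in direction $k$, $G'_i=G_i$ for $i\ne k$ and $G_k'=\underline b_k^-\cdot G=\underline b_k^+\cdot G$, giving the degrees of all quantum cluster variables. Here $\tilde{\underline x}$ and $\underline x$ both lie in the same skew-field $\mathcal F$. An isomorphism of graded quantum cluster algebras is a $\mathbb{K}$-algebra isomorphism carrying quantum clusters bijectively to quantum clusters, compatibly with mutation, the exchange and quasi-commutation matrices and the degrees. *)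

theory Defs
  imports
    "Jordan_Normal_Form.Matrix"
    "HOL-Computational_Algebra.Fraction_Field"
    "HOL-Computational_Algebra.Polynomial"
begin

text \<open>
  The ground field is the field of rational functions over the rationals in one variable, which is
  called \<open>qhalf\<close> and plays the role of the square root of \<open>q\<close>.
  The index set \<open>{1, ..., r}\<close> is represented by \<open>{0, ..., r - 1}\<close>, as usual for the
  vectors and matrices of the library.
\<close>

type_synonym qfield = "rat poly fract"

definition qhalf :: qfield where
  "qhalf = Fract [:0, 1:] 1"

definition q :: qfield where
  "q = qhalf ^ 2"

record 'f graded_seed =
  cluster :: "'f vec"
  exch :: "int mat"
  qcomm :: "int mat"
  grading :: "int vec"

definition b_plus :: "int mat \<Rightarrow> nat \<Rightarrow> int vec" where
  "b_plus B k = - unit_vec (dim_row B) k + vec (dim_row B) (\<lambda>i. if B $$ (i, k) > 0 then B $$ (i, k) else 0)"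

definition b_minus :: "int mat \<Rightarrow> nat \<Rightarrow> int vec" where
  "b_minus B k = - unit_vec (dim_row B) k - vec (dim_row B) (\<lambda>i. if B $$ (i, k) < 0 then B $$ (i, k) else 0)"

definition E_mat :: "int mat \<Rightarrow> nat \<Rightarrow> int mat" where
  "E_mat B k = mat (dim_row B) (dim_row B) (\<lambda>(i, j).
     if j \<noteq> k then (if i = j then 1 else 0)
     else if i = k then -1
     else max 0 (- B $$ (i, k)))"

text \<open>In the following, \<open>N\<close> is the set of mutable indices.\<close>

definition mutate_exch :: "nat set \<Rightarrow> nat \<Rightarrow> int mat \<Rightarrow> int mat" where
  "mutate_exch N k B = mat (dim_row B) (dim_row B) (\<lambda>(i, j).
     if i \<notin> N \<and> j \<notin> N then 0 else (E_mat B k * B * (E_mat B k)\<^sup>T) $$ (i, j))"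

definition mutate_qcomm :: "int mat \<Rightarrow> nat \<Rightarrow> int mat \<Rightarrow> int mat" where
  "mutate_qcomm B k L = (E_mat B k)\<^sup>T * L * E_mat B k"

text \<open>
  For a grading, \<open>b_minus\<close> and \<open>b_plus\<close> yield the same new degree.
\<close>

definition mutate_grading :: "int mat \<Rightarrow> nat \<Rightarrow> int vec \<Rightarrow> int vec" where
  "mutate_grading B k G = vec (dim_vec G) (\<lambda>i. if i = k then b_minus B k \<bullet> G else G $ i)"

definition compatible_pair :: "nat \<Rightarrow> nat set \<Rightarrow> int mat \<Rightarrow> int mat \<Rightarrow> bool" where
  "compatible_pair r N B L \<longleftrightarrow>
     (\<exists>d > 0. \<forall>i \<in> N. \<forall>j < r.
        (\<Sum>k<r. B $$ (k, i) * L $$ (k, j)) = (if i = j then d else 0))"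

definition map_seed :: "('f \<Rightarrow> 'f) \<Rightarrow> 'f graded_seed \<Rightarrow> 'f graded_seed" where
  "map_seed \<phi> S = S\<lparr>cluster := map_vec \<phi> (cluster S)\<rparr>"

locale skew_field_algebra = vector_space scale
  for scale :: "qfield \<Rightarrow> 'f :: division_ring \<Rightarrow> 'f" (infixr \<open>*s\<close> 75) +
  assumes scale_mult_left: "(c *s x) * y = c *s (x * y)"
    and scale_mult_right: "x * (c *s y) = c *s (x * y)"
begin

text \<open>
  The normalised ordered monomial \<open>M(a)\<close>; only invertible \<open>X\<^sub>i\<close> are relevant, as \<open>powi\<close> is total.
\<close>

definition qmonomial :: "'f vec \<Rightarrow> int mat \<Rightarrow> int vec \<Rightarrow> 'f" where
  "qmonomial X L a =
     (qhalf powi (\<Sum>j<dim_vec X. \<Sum>i<j. a $ i * a $ j * L $$ (j, i))) *s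
     prod_list (map (\<lambda>i. (X $ i) powi (a $ i)) [0..<dim_vec X])"

text \<open>
  By the quasi-commutation relations the span of the monomials is the subalgebra generated by all
  \<open>X\<^sub>i\<close> and their inverses. It is the quantum torus (and not a proper quotient of it) iff the family
  of monomials is linearly independent. The ambient division ring is then its skew-field of
  fractions iff each element is a right fraction of elements of this subalgebra.
\<close>

definition qtorus :: "'f vec \<Rightarrow> int mat \<Rightarrow> 'f set" where
  "qtorus X L = span (qmonomial X L ` carrier_vec (dim_vec X))"

definition fraction_field_of_qtorus :: "'f vec \<Rightarrow> int mat \<Rightarrow> bool" where
  "fraction_field_of_qtorus X L \<longleftrightarrow>
     (\<forall>i < dim_vec X. X $ i \<noteq> 0) \<and>
     (\<forall>i < dim_vec X. \<forall>j < dim_vec X. X $ i * X $ j = (q powi (L $$ (i, j))) *s (X $ j * X $ i)) \<and>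
     inj_on (qmonomial X L) (carrier_vec (dim_vec X)) \<and>
     independent (qmonomial X L ` carrier_vec (dim_vec X)) \<and>
     (\<forall>f. \<exists>a \<in> qtorus X L. \<exists>b \<in> qtorus X L. b \<noteq> 0 \<and> f = a * inverse b)"

definition quantum_seed :: "nat \<Rightarrow> nat set \<Rightarrow> 'f vec \<Rightarrow> int mat \<Rightarrow> int mat \<Rightarrow> bool" where
  "quantum_seed r N X B L \<longleftrightarrow>
     N \<subseteq> {..<r} \<and> X \<in> carrier_vec r \<and> B \<in> carrier_mat r r \<and> L \<in> carrier_mat r r \<and>
     L\<^sup>T = - L \<and> fraction_field_of_qtorus X L \<and>
     B\<^sup>T = - B \<and> (\<forall>i < r. \<forall>j < r. i \<notin> N \<longrightarrow> j \<notin> N \<longrightarrow> B $$ (i, j) = 0) \<and>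
     compatible_pair r N B L"

definition graded_quantum_seed :: "nat \<Rightarrow> nat set \<Rightarrow> 'f graded_seed \<Rightarrow> bool" where
  "graded_quantum_seed r N S \<longleftrightarrow>
     quantum_seed r N (cluster S) (exch S) (qcomm S) \<and>
     grading S \<in> carrier_vec r \<and> (\<forall>i \<in> N. row (exch S) i \<bullet> grading S = 0)"

definition mutate_cluster :: "nat \<Rightarrow> 'f vec \<Rightarrow> int mat \<Rightarrow> int mat \<Rightarrow> 'f vec" where
  "mutate_cluster k X B L = vec (dim_vec X) (\<lambda>i.
     if i = k then qmonomial X L (b_plus B k) + qmonomial X L (b_minus B k) else X $ i)"

definition mutate :: "nat set \<Rightarrow> nat \<Rightarrow> 'f graded_seed \<Rightarrow> 'f graded_seed" where
  "mutate N k S =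
     \<lparr>cluster = mutate_cluster k (cluster S) (exch S) (qcomm S),
      exch = mutate_exch N k (exch S),
      qcomm = mutate_qcomm (exch S) k (qcomm S),
      grading = mutate_grading (exch S) k (grading S)\<rparr>"

inductive_set seeds :: "nat set \<Rightarrow> 'f graded_seed \<Rightarrow> 'f graded_seed set"
  for N :: "nat set" and S :: "'f graded_seed" where
  initial: "S \<in> seeds N S"
| mutation: "T \<in> seeds N S \<Longrightarrow> k \<in> N \<Longrightarrow> mutate N k T \<in> seeds N S"

definition clusters :: "nat set \<Rightarrow> 'f graded_seed \<Rightarrow> 'f vec set" where
  "clusters N S = cluster ` seeds N S"

definition cluster_variables :: "nat set \<Rightarrow> 'f graded_seed \<Rightarrow> 'f set" where
  "cluster_variables N S = (\<Union>X \<in> clusters N S. {X $ i | i. i < dim_vec X})"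

definition subalgebra :: "'f set \<Rightarrow> bool" where
  "subalgebra A \<longleftrightarrow>
     1 \<in> A \<and> (\<forall>x \<in> A. \<forall>y \<in> A. x + y \<in> A \<and> x * y \<in> A) \<and> (\<forall>c. \<forall>x \<in> A. c *s x \<in> A)"

definition quantum_cluster_algebra :: "nat set \<Rightarrow> 'f graded_seed \<Rightarrow> 'f set" where
  "quantum_cluster_algebra N S = subalgebra hull cluster_variables N S"

definition algebra_iso :: "'f set \<Rightarrow> 'f set \<Rightarrow> ('f \<Rightarrow> 'f) \<Rightarrow> bool" where
  "algebra_iso A A' \<phi> \<longleftrightarrow>
     bij_betw \<phi> A A' \<and> \<phi> 1 = 1 \<and>
     (\<forall>x \<in> A. \<forall>y \<in> A. \<phi> (x + y) = \<phi> x + \<phi> y \<and> \<phi> (x * y) = \<phi> x * \<phi> y) \<and>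
     (\<forall>c. \<forall>x \<in> A. \<phi> (c *s x) = c *s \<phi> x)"

text \<open>
  An isomorphism applies to clusters entrywise and preserves the labelling of cluster variables.
  Since \<open>map_seed\<close> leaves the two matrices and the grading unchanged, the bijection on seeds says
  that these data agree in corresponding seeds.
\<close>

definition graded_qca_iso ::
  "nat set \<Rightarrow> 'f graded_seed \<Rightarrow> 'f graded_seed \<Rightarrow> ('f \<Rightarrow> 'f) \<Rightarrow> bool" where
  "graded_qca_iso N S S' \<phi> \<longleftrightarrow>
     algebra_iso (quantum_cluster_algebra N S) (quantum_cluster_algebra N S') \<phi> \<and>
     bij_betw (map_vec \<phi>) (clusters N S) (clusters N S') \<and>
     bij_betw (map_seed \<phi>) (seeds N S) (seeds N S') \<and>
     (\<forall>T \<in> seeds N S. \<forall>k \<in> N. map_seed \<phi> (mutate N k T) = mutate N k (map_seed \<phi> T))"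

definition twisted_seed :: "'f graded_seed \<Rightarrow> 'f graded_seed" where
  "twisted_seed S = S\<lparr>cluster :=
     vec (dim_vec (cluster S)) (\<lambda>i. (qhalf powi (grading S $ i)) *s (cluster S $ i))\<rparr>"

end

end

theory Submission
  imports Defs
begin

text \<open>
  The matrices and the grading do not change, so all that is needed is an automorphism of the
  ambient skew-field sending each \<open>X\<^sub>i\<close> to \<open>q\<^bsup>G\<^sub>i/2\<^esup>X\<^sub>i\<close>:
  mutation is given by rational expressions and hence commutes with every automorphism, so its
  inverse carries the twisted seeds to the seeds. On the quantum torus the automorphism scales
  \<open>M(a)\<close> by \<open>q\<^bsup>a\<cdot>G/2\<^esup>\<close>, which is multiplicative since \<open>M(a)M(b)\<close> is a
  scalar multiple of \<open>M(a + b)\<close>; it extends to the skew-field of fractions by Ore localisation.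
\<close>

section \<open>Ore localisation\<close>

text \<open>The extension sends \<open>x\<close> to
  \<open>\<sigma> (x * b) * inverse (\<sigma> b)\<close> for any denominator \<open>b\<close>. The
  right Ore condition, by which two denominators have a common multiple, follows from
  \<open>fractions\<close>; nonvanishing of \<open>\<sigma>\<close> keeps the images of denominators
  invertible.\<close>

lemma ring_hom_extends_to_right_fractions:
  fixes T :: "'a :: division_ring set" and \<sigma> :: "'a \<Rightarrow> 'a"
  assumes add: "\<And>x y. x \<in> T \<Longrightarrow> y \<in> T \<Longrightarrow> x + y \<in> T"
    and mult: "\<And>x y. x \<in> T \<Longrightarrow> y \<in> T \<Longrightarrow> x * y \<in> T"
    and one: "1 \<in> T"
    and fractions: "\<And>x. \<exists>a \<in> T. \<exists>b \<in> T. b \<noteq> 0 \<and> x = a * inverse b"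
    and \<sigma>_add: "\<And>x y. x \<in> T \<Longrightarrow> y \<in> T \<Longrightarrow> \<sigma> (x + y) = \<sigma> x + \<sigma> y"
    and \<sigma>_mult: "\<And>x y. x \<in> T \<Longrightarrow> y \<in> T \<Longrightarrow> \<sigma> (x * y) = \<sigma> x * \<sigma> y"
    and \<sigma>_one: "\<sigma> 1 = 1"
    and \<sigma>_nonzero: "\<And>x. x \<in> T \<Longrightarrow> x \<noteq> 0 \<Longrightarrow> \<sigma> x \<noteq> 0"
  shows "\<exists>\<psi>. (\<forall>x y. \<psi> (x + y) = \<psi> x + \<psi> y) \<and> (\<forall>x y. \<psi> (x * y) = \<psi> x * \<psi> y) \<and>
    (\<forall>x \<in> T. \<psi> x = \<sigma> x)"
proof -
  \<comment> \<open>An element has many denominators; \<open>val x b\<close> turns out to be the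
    same for all \<open>b\<close> in \<open>D x\<close>.\<close>
  define D where "D x = {b \<in> T. b \<noteq> 0 \<and> x * b \<in> T}" for x
  define val where "val x b = \<sigma> (x * b) * inverse (\<sigma> b)" for x b
  have D_nonempty: "\<exists>b. b \<in> D x" for x
  proof -
    obtain a b where "a \<in> T" "b \<in> T" "b \<noteq> 0" "x = a * inverse b"
      using fractions by blast
    then have "b \<in> D x"
      by (simp add: D_def mult.assoc)
    then show ?thesis ..
  qed
  \<comment> \<open>A right factor \<open>e\<close> of the denominator contributes
    \<open>\<sigma> e\<close> above and below, which cancels.\<close>
  have D_mult: "b * e \<in> D x" and val_mult: "val x (b * e) = val x b"
    if "b \<in> D x" "e \<in> T" "e \<noteq> 0" for x b e
  proof -
    show "b * e \<in> D x"
      using that mult[of b e] mult[of "x * b" e] by (simp add: D_def mult.assoc)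
    have "\<sigma> (x * (b * e)) = \<sigma> (x * b) * \<sigma> e"
      using that \<sigma>_mult[of "x * b" e] by (simp add: D_def mult.assoc)
    moreover have "\<sigma> (b * e) = \<sigma> b * \<sigma> e" "\<sigma> b \<noteq> 0" "\<sigma> e \<noteq> 0"
      using that \<sigma>_mult \<sigma>_nonzero by (auto simp: D_def)
    ultimately show "val x (b * e) = val x b"
      by (simp add: val_def nonzero_inverse_mult_distrib mult.assoc)
        (simp flip: mult.assoc)
  qed
  \<comment> \<open>Writing \<open>inverse b * d\<close> as a fraction \<open>e * inverse f\<close>
    yields the common right multiple.\<close>
  have ore: "\<exists>e f. e \<in> T \<and> f \<in> T \<and> e \<noteq> 0 \<and> f \<noteq> 0 \<and> b * e = d * f"
    if nz: "b \<noteq> 0" "d \<noteq> 0" for b d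
  proof -
    obtain e f where ef: "e \<in> T" "f \<in> T" "f \<noteq> 0" "inverse b * d = e * inverse f"
      using fractions by blast
    have "b * e = b * (e * inverse f) * f"
      using ef by (simp add: mult.assoc)
    also have "\<dots> = d * f"
      unfolding ef(4)[symmetric] using nz by (simp flip: mult.assoc)
    finally have "b * e = d * f" .
    moreover from this have "e \<noteq> 0"
      using nz ef by auto
    ultimately show ?thesis
      using ef by blast
  qed
  have val_unique: "val x b = val x d" if bd: "b \<in> D x" "d \<in> D x" for x b d
  proof -
    obtain e f where ef: "e \<in> T" "f \<in> T" "e \<noteq> 0" "f \<noteq> 0" "b * e = d * f"
      using ore[of b d] bd by (auto simp: D_def)
    then show ?thesis
      using val_mult[of b x e] val_mult[of d x f] bd by simp
  qed
  define \<psi> where "\<psi> x = val x (SOME b. b \<in> D x)" for x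
  have \<psi>_eq: "\<psi> x = val x b" if "b \<in> D x" for x b
    unfolding \<psi>_def by (rule val_unique[OF someI that]) (rule that)
  have "\<psi> (x + y) = \<psi> x + \<psi> y" for x y
  proof -
    obtain b d where bd: "b \<in> D x" "d \<in> D y"
      using D_nonempty by blast
    obtain e f where ef: "e \<in> T" "f \<in> T" "e \<noteq> 0" "f \<noteq> 0" "b * e = d * f"
      using ore[of b d] bd by (auto simp: D_def)
    \<comment> \<open>\<open>c\<close> is a common denominator of \<open>x\<close> and
      \<open>y\<close>, over which the sum can be computed.\<close>
    define c where "c = b * e"
    have c: "c \<in> D x" "c \<in> D y"
      using D_mult[OF bd(1) ef(1,3)] D_mult[OF bd(2) ef(2,4)] ef(5) by (simp_all add: c_def)
    then have "c \<in> D (x + y)"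
      using add[of "x * c" "y * c"] by (simp add: D_def distrib_right)
    then have "\<psi> (x + y) = val (x + y) c"
      by (rule \<psi>_eq)
    also have "\<dots> = val x c + val y c"
      using c \<sigma>_add by (simp add: val_def D_def distrib_right)
    finally show ?thesis
      using \<psi>_eq c by simp
  qed
  moreover have \<psi>_T: "\<psi> x = \<sigma> x" if "x \<in> T" for x
    using \<psi>_eq[of 1 x] that one \<sigma>_one by (simp add: D_def val_def)
  moreover have "\<psi> (x * y) = \<psi> x * \<psi> y" for x y
  proof -
    obtain b where b: "b \<in> D y"
      using D_nonempty by blast
    obtain d where d: "d \<in> D x"
      using D_nonempty by blast
    show ?thesis
    \<comment> \<open>The common multiple taken below needs \<open>y * b\<close> nonzero; for
      \<open>y = 0\<close>, additivity gives \<open>\<psi> 0 = 0\<close>.\<close>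
    proof (cases "y = 0")
      case True
      have "\<psi> (0 + 0) = \<psi> 0 + \<psi> 0"
        by fact
      then show ?thesis
        using True by simp
    next
      case False
      then have "y * b \<noteq> 0" "d \<noteq> 0"
        using b d by (auto simp: D_def)
      \<comment> \<open>The multiple is chosen so that the numerator of \<open>y\<close> over
        \<open>b * e\<close> is a denominator \<open>d * f\<close> of \<open>x\<close>; in the
        product of the two values the middle factors then cancel.\<close>
      then obtain e f where ef: "e \<in> T" "f \<in> T" "e \<noteq> 0" "f \<noteq> 0" "y * b * e = d * f"
        using ore by blast
      have yc: "y * (b * e) = d * f"
        using ef(5) by (simp add: mult.assoc)
      have c: "b * e \<in> D y" "d * f \<in> D x"
        using D_mult b d ef by auto
      then have "b * e \<in> D (x * y)"
        using yc by (auto simp: D_def mult.assoc)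
      then have "\<psi> (x * y) = \<sigma> (x * (d * f)) * inverse (\<sigma> (b * e))"
        using \<psi>_eq by (simp add: val_def yc mult.assoc)
      also have "\<dots> = val x (d * f) * val y (b * e)"
      proof -
        have "\<sigma> (d * f) \<noteq> 0"
          using c(2) \<sigma>_nonzero by (auto simp: D_def)
        then have "inverse (\<sigma> (d * f)) * (\<sigma> (d * f) * z) = z" for z
          by (simp flip: mult.assoc)
        then show ?thesis
          by (simp add: val_def yc mult.assoc)
      qed
      also have "\<dots> = \<psi> x * \<psi> y"
        using \<psi>_eq c by simp
      finally show ?thesis .
    qed
  qed
  ultimately show ?thesis
    by blast
qed

context skew_field_algebra
begin

section \<open>Transport along automorphisms\<close>

lemma algebra_isoD:
  assumes "algebra_iso UNIV UNIV \<psi>"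
  shows "bij \<psi>" "\<psi> 1 = 1" "\<psi> 0 = 0" "\<psi> (x + y) = \<psi> x + \<psi> y" "\<psi> (x * y) = \<psi> x * \<psi> y"
    "\<psi> (c *s x) = c *s \<psi> x"
proof -
  show "bij \<psi>" "\<psi> 1 = 1" "\<psi> (x + y) = \<psi> x + \<psi> y" "\<psi> (x * y) = \<psi> x * \<psi> y"
    "\<psi> (c *s x) = c *s \<psi> x"
    using assms by (auto simp: algebra_iso_def)
  have "\<psi> (0 + 0) = \<psi> 0 + \<psi> 0"
    using assms unfolding algebra_iso_def by blast
  then show "\<psi> 0 = 0"
    by simp
qed

lemma algebra_iso_inv:
  assumes "algebra_iso UNIV UNIV \<psi>"
  shows "algebra_iso UNIV UNIV (inv_into UNIV \<psi>)"
proof -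
  note D = algebra_isoD[OF assms]
  have eqI: "inv_into UNIV \<psi> z = x" if "\<psi> x = z" for x z
    using D(1) that by (metis bij_inv_eq_iff)
  have "\<psi> (inv_into UNIV \<psi> x) = x" for x
    using D(1) by (metis bij_inv_eq_iff)
  then show ?thesis
    unfolding algebra_iso_def using D bij_imp_bij_inv[OF D(1)] by (auto intro!: eqI)
qed

lemma algebra_iso_inverse:
  assumes "algebra_iso UNIV UNIV \<psi>"
  shows "\<psi> (inverse x) = inverse (\<psi> x)"
proof (cases "x = 0")
  case False
  then have "\<psi> x * \<psi> (inverse x) = 1"
    using algebra_isoD(2,5)[OF assms] by (metis right_inverse)
  then show ?thesis
    by (metis inverse_unique)
qed (simp add: algebra_isoD(3)[OF assms])

lemma algebra_iso_powi:
  assumes "algebra_iso UNIV UNIV \<psi>"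
  shows "\<psi> (x powi n) = \<psi> x powi n"
proof -
  have "\<psi> (x ^ m) = \<psi> x ^ m" for x and m :: nat
    by (induction m) (simp_all add: algebra_isoD(2,5)[OF assms])
  then show ?thesis
    by (simp add: power_int_def algebra_iso_inverse[OF assms])
qed

lemma algebra_iso_prod_list:
  assumes "algebra_iso UNIV UNIV \<psi>"
  shows "\<psi> (prod_list xs) = prod_list (map \<psi> xs)"
  by (induction xs) (simp_all add: algebra_isoD(2,5)[OF assms])

lemma algebra_iso_linear:
  assumes "algebra_iso UNIV UNIV \<psi>"
  shows "Vector_Spaces.linear scale scale \<psi>"
  unfolding Vector_Spaces.linear_iff
  using algebra_isoD(4,6)[OF assms] vector_space_axioms by auto

section \<open>Quantum tori under automorphisms\<close>

text \<open>\<open>L\<close> enters only through a scalar, and \<open>\<psi>\<close> respects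
  scalars, integer powers and ordered products. The transport of tori and of mutation rests on
  this.\<close>

lemma qmonomial_map_vec:
  assumes "algebra_iso UNIV UNIV \<psi>"
  shows "qmonomial (map_vec \<psi> X) L a = \<psi> (qmonomial X L a)"
proof -
  have "map (\<lambda>i. (map_vec \<psi> X $ i) powi (a $ i)) [0..<dim_vec X]
      = map \<psi> (map (\<lambda>i. (X $ i) powi (a $ i)) [0..<dim_vec X])"
    by (simp add: algebra_iso_powi[OF assms])
  then show ?thesis
    unfolding qmonomial_def
    by (simp only: algebra_isoD(6)[OF assms] algebra_iso_prod_list[OF assms] index_map_vec(2))
qed

lemma qmonomial_image_map_vec:
  assumes "algebra_iso UNIV UNIV \<psi>"
  shows "qmonomial (map_vec \<psi> X) L ` A = \<psi> ` qmonomial X L ` A"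
  by (simp add: image_image qmonomial_map_vec[OF assms])

lemma qtorus_map_vec:
  assumes "algebra_iso UNIV UNIV \<psi>"
  shows "qtorus (map_vec \<psi> X) L = \<psi> ` qtorus X L"
proof -
  interpret vector_space_pair scale scale ..
  show ?thesis
    by (simp add: qtorus_def qmonomial_image_map_vec[OF assms]
        linear_span_image[OF algebra_iso_linear[OF assms]])
qed

text \<open>Every clause is preserved by automorphisms: surjectivity of \<open>\<psi>\<close> serves
  the representation by fractions, injectivity serves nonvanishing, distinctness and independence of
  the monomials.\<close>

lemma fraction_field_of_qtorus_map_vec:
  assumes \<psi>: "algebra_iso UNIV UNIV \<psi>" and ff: "fraction_field_of_qtorus X L"
  shows "fraction_field_of_qtorus (map_vec \<psi> X) L"
proof -
  interpret vector_space_pair scale scale ..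
  note D = algebra_isoD[OF \<psi>]
  have inj: "inj \<psi>"
    using D(1) by (rule bij_is_inj)
  have "\<exists>a \<in> \<psi> ` qtorus X L. \<exists>b \<in> \<psi> ` qtorus X L. b \<noteq> 0 \<and> f = a * inverse b" for f
  proof -
    obtain g where g: "f = \<psi> g"
      using D(1) by (metis bij_pointE)
    obtain a b where ab: "a \<in> qtorus X L" "b \<in> qtorus X L" "b \<noteq> 0" "g = a * inverse b"
      using ff unfolding fraction_field_of_qtorus_def by blast
    moreover have "\<psi> b \<noteq> 0"
      using ab inj D(3) by (metis injD)
    moreover have "f = \<psi> a * inverse (\<psi> b)"
      using g ab(4) D(5) algebra_iso_inverse[OF \<psi>] by simp
    ultimately show ?thesis
      by blast
  qed
  moreover have "map_vec \<psi> X $ i \<noteq> 0" if "i < dim_vec X" for i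
    using ff that inj D(3) unfolding fraction_field_of_qtorus_def by (metis injD index_map_vec(1))
  moreover have "map_vec \<psi> X $ i * map_vec \<psi> X $ j
      = (q powi (L $$ (i, j))) *s (map_vec \<psi> X $ j * map_vec \<psi> X $ i)"
    if "i < dim_vec X" "j < dim_vec X" for i j
  proof -
    have "X $ i * X $ j = (q powi (L $$ (i, j))) *s (X $ j * X $ i)"
      using ff that unfolding fraction_field_of_qtorus_def by blast
    then have "\<psi> (X $ i * X $ j) = \<psi> ((q powi (L $$ (i, j))) *s (X $ j * X $ i))"
      by (rule arg_cong)
    then show ?thesis
      by (simp only: D(5,6) index_map_vec(1) that)
  qed
  moreover have "inj_on (qmonomial (map_vec \<psi> X) L) (carrier_vec (dim_vec X))"
    using ff inj unfolding fraction_field_of_qtorus_def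
    by (auto simp: inj_on_def qmonomial_map_vec[OF \<psi>])
  moreover have "independent (\<psi> ` qmonomial X L ` carrier_vec (dim_vec X))"
    using ff inj unfolding fraction_field_of_qtorus_def
    by (intro linear_independent_injective_image algebra_iso_linear[OF \<psi>]) (auto intro: inj_on_subset)
  ultimately show ?thesis
    unfolding fraction_field_of_qtorus_def qtorus_map_vec[OF \<psi>] qmonomial_image_map_vec[OF \<psi>]
      index_map_vec(2)
    by blast
qed

section \<open>Seeds, mutation and clusters under automorphisms\<close>

lemma graded_quantum_seed_map_seed:
  assumes "algebra_iso UNIV UNIV \<psi>" and "graded_quantum_seed r N S"
  shows "graded_quantum_seed r N (map_seed \<psi> S)"
  using assms fraction_field_of_qtorus_map_vec[OF assms(1)]
  by (simp add: graded_quantum_seed_def quantum_seed_def map_seed_def)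

text \<open>The new cluster variable is a sum of two normalised monomials, and the other components
  of a mutated seed do not depend on the cluster.\<close>

lemma map_seed_mutate:
  assumes "algebra_iso UNIV UNIV \<psi>"
  shows "map_seed \<psi> (mutate N k S) = mutate N k (map_seed \<psi> S)"
proof -
  have "map_vec \<psi> (mutate_cluster k X B L) = mutate_cluster k (map_vec \<psi> X) B L" for X B L
    by (rule eq_vecI)
      (simp_all add: mutate_cluster_def qmonomial_map_vec[OF assms] algebra_isoD(4)[OF assms])
  then show ?thesis
    by (simp add: map_seed_def mutate_def)
qed

lemma seeds_map_seed:
  assumes "algebra_iso UNIV UNIV \<psi>"
  shows "seeds N (map_seed \<psi> S) = map_seed \<psi> ` seeds N S"
proof
  show "seeds N (map_seed \<psi> S) \<subseteq> map_seed \<psi> ` seeds N S"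
  proof
    fix T assume "T \<in> seeds N (map_seed \<psi> S)"
    then show "T \<in> map_seed \<psi> ` seeds N S"
      by induction (auto intro: seeds.intros simp flip: map_seed_mutate[OF assms])
  qed
  have "map_seed \<psi> T \<in> seeds N (map_seed \<psi> S)" if "T \<in> seeds N S" for T
    using that by induction (auto intro: seeds.intros simp: map_seed_mutate[OF assms])
  then show "map_seed \<psi> ` seeds N S \<subseteq> seeds N (map_seed \<psi> S)"
    by blast
qed

lemma clusters_map_seed:
  assumes "algebra_iso UNIV UNIV \<psi>"
  shows "clusters N (map_seed \<psi> S) = map_vec \<psi> ` clusters N S"
proof -
  have "cluster (map_seed \<psi> T) = map_vec \<psi> (cluster T)" for T
    by (simp add: map_seed_def)
  then show ?thesis
    by (simp add: clusters_def seeds_map_seed[OF assms] image_image)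
qed

lemma cluster_variables_map_seed:
  assumes "algebra_iso UNIV UNIV \<psi>"
  shows "cluster_variables N (map_seed \<psi> S) = \<psi> ` cluster_variables N S"
proof -
  have "{map_vec \<psi> X $ i | i. i < dim_vec X} = \<psi> ` {X $ i | i. i < dim_vec X}" for X
    by (force simp: image_iff)
  then show ?thesis
    by (simp add: cluster_variables_def clusters_map_seed[OF assms] image_UN)
qed

section \<open>Generated subalgebras and the induced isomorphism\<close>

lemma subalgebra_image:
  assumes "algebra_iso UNIV UNIV \<psi>" and "subalgebra A"
  shows "subalgebra (\<psi> ` A)"
  using assms(2) algebra_isoD(2)[OF assms(1)]
  unfolding subalgebra_def
  by (auto simp flip: algebra_isoD(4,5,6)[OF assms(1)] intro: image_eqI[of 1 \<psi> 1])

text \<open>The image of the hull is a subalgebra containing the images of the generators, which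
  gives one inclusion for every automorphism; the same inclusion for the inverse automorphism gives
  the other.\<close>

lemma subalgebra_hull_image:
  assumes "algebra_iso UNIV UNIV \<psi>"
  shows "subalgebra hull (\<psi> ` V) = \<psi> ` (subalgebra hull V)"
proof -
  \<comment> \<open>Intersections of subalgebras are subalgebras.\<close>
  have hull: "subalgebra (subalgebra hull V)" for V
    by (rule hull_in) (auto simp: subalgebra_def)
  have le: "subalgebra hull (\<phi> ` U) \<subseteq> \<phi> ` (subalgebra hull U)"
    if "algebra_iso UNIV UNIV \<phi>" for \<phi> U
    using that by (intro hull_minimal subalgebra_image hull image_mono hull_subset)
  have "bij \<psi>"
    by (rule algebra_isoD(1)[OF assms])
  then have "\<psi> ` inv_into UNIV \<psi> ` W = W" "inv_into UNIV \<psi> ` \<psi> ` W = W" for W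
    by (simp_all add: image_inv_f_f bij_is_inj image_f_inv_f bij_is_surj)
  then show ?thesis
    using le[OF assms, of V] le[OF algebra_iso_inv[OF assms], of "\<psi> ` V"]
    by (metis image_mono subset_antisym)
qed

text \<open>The transport equations give surjectivity onto the new algebra, clusters and seeds, and
  injectivity of \<open>\<psi>\<close> lifts entrywise. Since \<open>S\<close> is arbitrary, the
  twisted seed can be taken as the source.\<close>

lemma graded_qca_iso_map_seed:
  assumes "algebra_iso UNIV UNIV \<psi>"
  shows "graded_qca_iso N S (map_seed \<psi> S) \<psi>"
proof -
  note D = algebra_isoD[OF assms]
  have inj: "inj \<psi>"
    using D(1) by (rule bij_is_inj)
  have inj_vec: "inj (map_vec \<psi>)"
  proof (rule injI)
    fix X Y assume eq: "map_vec \<psi> X = map_vec \<psi> Y"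
    then have dim: "dim_vec X = dim_vec Y"
      by (metis index_map_vec(2))
    show "X = Y"
    proof (rule eq_vecI)
      fix i assume "i < dim_vec Y"
      then have "\<psi> (X $ i) = \<psi> (Y $ i)"
        using eq dim by (metis index_map_vec(1))
      then show "X $ i = Y $ i"
        using inj by (rule injD[rotated])
    qed (rule dim)
  qed
  have "inj (map_seed \<psi>)"
  proof (rule injI)
    fix T U assume "map_seed \<psi> T = map_seed \<psi> U"
    then show "T = U"
      by (cases T; cases U) (auto simp: map_seed_def dest: injD[OF inj_vec])
  qed
  moreover have "quantum_cluster_algebra N (map_seed \<psi> S) = \<psi> ` quantum_cluster_algebra N S"
    by (simp add: quantum_cluster_algebra_def cluster_variables_map_seed[OF assms]
        subalgebra_hull_image[OF assms])
  ultimately show ?thesis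
    using D inj inj_vec
    by (auto simp: graded_qca_iso_def algebra_iso_def bij_betw_def seeds_map_seed[OF assms]
        clusters_map_seed[OF assms] map_seed_mutate[OF assms] intro: inj_on_subset)
qed

section \<open>Diagonal automorphisms\<close>

lemma qhalf_nonzero: "qhalf \<noteq> 0"
  by (simp add: qhalf_def Zero_fract_def eq_fract)

section \<open>Commutation up to a nonzero scalar\<close>

text \<open>The scalar stays unspecified, because multiplicativity of the diagonal map needs
  products of monomials only up to a scalar. Its being nonzero makes the relation symmetric.\<close>

definition quasi_commute :: "'f \<Rightarrow> 'f \<Rightarrow> bool" where
  "quasi_commute x y \<longleftrightarrow> (\<exists>c \<noteq> 0. x * y = c *s (y * x))"

lemma quasi_commute_sym: "quasi_commute x y \<Longrightarrow> quasi_commute y x"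
proof -
  assume "quasi_commute x y"
  then obtain c where c: "c \<noteq> 0" "x * y = c *s (y * x)"
    unfolding quasi_commute_def by blast
  then have "y * x = inverse c *s (x * y)"
    by simp
  then show ?thesis
    unfolding quasi_commute_def using c by (metis nonzero_imp_inverse_nonzero)
qed

lemma quasi_commute_1: "quasi_commute x 1"
  unfolding quasi_commute_def by (rule exI[of _ 1]) simp

lemma quasi_commute_mult:
  assumes "quasi_commute x y" "quasi_commute x z"
  shows "quasi_commute x (y * z)"
proof -
  obtain c d where cd: "c \<noteq> 0" "x * y = c *s (y * x)" "d \<noteq> 0" "x * z = d *s (z * x)"
    using assms unfolding quasi_commute_def by blast
  have "x * (y * z) = (c *s (y * x)) * z"
    by (simp flip: cd(2) mult.assoc)
  also have "\<dots> = c *s (y * (x * z))"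
    by (simp add: scale_mult_left mult.assoc)
  also have "\<dots> = (c * d) *s (y * z * x)"
    by (simp add: cd(4) scale_mult_right mult.assoc)
  finally show ?thesis
    unfolding quasi_commute_def using cd by (metis mult_eq_0_iff)
qed

lemma quasi_commute_inverse:
  assumes "quasi_commute x y"
  shows "quasi_commute x (inverse y)"
\<comment> \<open>By the convention \<open>inverse 0 = 0\<close>, the case \<open>y = 0\<close> is
  the assumption itself.\<close>
proof (cases "y = 0")
  case False
  obtain c where c: "c \<noteq> 0" "y * x = c *s (x * y)"
    using quasi_commute_sym[OF assms] unfolding quasi_commute_def by blast
  have "x * inverse y = inverse y * (y * x) * inverse y"
    using False by (simp flip: mult.assoc)
  also have "\<dots> = c *s (inverse y * x)"
    using False by (simp add: c scale_mult_left scale_mult_right mult.assoc)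
  finally show ?thesis
    unfolding quasi_commute_def using c by blast
qed (use assms in simp)

lemma quasi_commute_powi:
  assumes "quasi_commute x y"
  shows "quasi_commute x (y powi n)"
proof -
  have "quasi_commute x (y ^ m)" for m :: nat
    by (induction m) (simp_all add: quasi_commute_1 quasi_commute_mult assms)
  then show ?thesis
    by (simp add: power_int_def quasi_commute_inverse power_inverse)
qed

section \<open>Ordered monomials and their span\<close>

text \<open>The power of \<open>qhalf\<close> in \<open>qmonomial\<close> is dropped, and the
  product is cut off after the first \<open>n\<close> variables to allow induction on
  \<open>n\<close>.\<close>

definition ordered_monomial :: "'f vec \<Rightarrow> int vec \<Rightarrow> nat \<Rightarrow> 'f" where
  "ordered_monomial X a n = prod_list (map (\<lambda>i. (X $ i) powi (a $ i)) [0..<n])"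

lemma ordered_monomial_Suc:
  "ordered_monomial X a (Suc n) = ordered_monomial X a n * (X $ n) powi (a $ n)"
  by (simp add: ordered_monomial_def)

lemma quasi_commute_ordered_monomial:
  assumes "\<And>i. i < n \<Longrightarrow> quasi_commute x (X $ i)"
  shows "quasi_commute x (ordered_monomial X a n)"
  using assms
  by (induction n)
    (simp_all add: ordered_monomial_Suc quasi_commute_mult quasi_commute_powi,
      simp add: ordered_monomial_def quasi_commute_1)

text \<open>Moving the last power of the left factor past the shorter right monomial costs a scalar,
  after which the exponents of the last variable add because it is invertible. The bound on
  \<open>n\<close> concerns \<open>b\<close> since vector addition takes its dimension from the
  second summand.\<close>

lemma ordered_monomial_mult:
  assumes "\<And>i. i < n \<Longrightarrow> X $ i \<noteq> 0"
    and "\<And>i j. i < n \<Longrightarrow> j < n \<Longrightarrow> quasi_commute (X $ i) (X $ j)"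
    and "n \<le> dim_vec b"
  shows "\<exists>c. ordered_monomial X a n * ordered_monomial X b n = c *s ordered_monomial X (a + b) n"
  using assms
proof (induction n)
  case 0
  show ?case
    by (rule exI[of _ 1]) (simp add: ordered_monomial_def)
next
  case (Suc n)
  let ?P = "\<lambda>a. ordered_monomial X a n" and ?x = "\<lambda>a. (X $ n) powi (a $ n)"
  obtain c where c: "?P a * ?P b = c *s ?P (a + b)"
    using Suc by fastforce
  have "quasi_commute (?x a) (?P b)"
    by (intro quasi_commute_ordered_monomial quasi_commute_sym[OF quasi_commute_powi])
      (use Suc.prems in auto)
  then obtain d where d: "?x a * ?P b = d *s (?P b * ?x a)"
    unfolding quasi_commute_def by blast
  have "?P a * ?x a * (?P b * ?x b) = ?P a * (?x a * ?P b) * ?x b"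
    by (simp add: mult.assoc)
  also have "\<dots> = d *s (?P a * ?P b * (?x a * ?x b))"
    by (simp add: d scale_mult_left scale_mult_right mult.assoc)
  also have "?x a * ?x b = ?x (a + b)"
    using Suc.prems(1)[of n] Suc.prems(3) by (simp add: power_int_add)
  also have "d *s (?P a * ?P b * ?x (a + b)) = (d * c) *s (?P (a + b) * ?x (a + b))"
    by (simp add: c scale_mult_left)
  finally show ?case
    unfolding ordered_monomial_Suc by blast
qed

lemma ordered_monomial_0: "n \<le> r \<Longrightarrow> ordered_monomial X (0\<^sub>v r) n = 1"
  by (induction n) (simp_all add: ordered_monomial_Suc, simp add: ordered_monomial_def)

lemma ordered_monomial_unit_vec:
  "n \<le> r \<Longrightarrow> ordered_monomial X (unit_vec r i) n = (if i < n then X $ i else 1)"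
  by (induction n) (auto simp: ordered_monomial_Suc less_Suc_eq unit_vec_def, simp add: ordered_monomial_def)

lemma qmonomial_eq_scale_ordered_monomial:
  "\<exists>c \<noteq> 0. qmonomial X L a = c *s ordered_monomial X a (dim_vec X)"
  unfolding qmonomial_def ordered_monomial_def
  using power_int_not_zero[OF disjI1[OF qhalf_nonzero]] by blast

text \<open>Normalised and ordered monomials differ by invertible scalars.\<close>

lemma qtorus_eq_span_ordered_monomial:
  "qtorus X L = span ((\<lambda>a. ordered_monomial X a (dim_vec X)) ` carrier_vec (dim_vec X))"
    (is "_ = span (?P ` ?C)")
proof -
  have "qmonomial X L a \<in> span (?P ` ?C)" if "a \<in> ?C" for a
    using qmonomial_eq_scale_ordered_monomial[of X L a] that by (metis imageI span_base span_scale)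
  moreover have "?P a \<in> span (qmonomial X L ` ?C)" if a: "a \<in> ?C" for a
  proof -
    obtain c where c: "c \<noteq> 0" "qmonomial X L a = c *s ?P a"
      using qmonomial_eq_scale_ordered_monomial by blast
    then have "?P a = inverse c *s qmonomial X L a"
      by simp
    then show ?thesis
      using a by (metis imageI span_base span_scale)
  qed
  ultimately show ?thesis
    unfolding qtorus_def by (intro span_eq[THEN iffD2]) auto
qed

text \<open>A linear map may be prescribed freely on an independent family. It is defined on the
  whole skew-field, but only its values on the torus are controlled.\<close>

lemma linear_scaling_of_monomials:
  assumes "fraction_field_of_qtorus X L"
  shows "\<exists>\<sigma>. Vector_Spaces.linear scale scale \<sigma> \<and>
    (\<forall>a \<in> carrier_vec (dim_vec X).
      \<sigma> (ordered_monomial X a (dim_vec X)) = w a *s ordered_monomial X a (dim_vec X))"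
proof -
  interpret vector_space_pair scale scale ..
  let ?C = "carrier_vec (dim_vec X)" and ?M = "qmonomial X L"
  have inj: "inj_on ?M ?C" and ind: "independent (?M ` ?C)"
    using assms by (auto simp: fraction_field_of_qtorus_def)
  \<comment> \<open>Distinct exponents give distinct monomials, so \<open>inv_into\<close> recovers
    the exponent on which the weight depends.\<close>
  obtain \<sigma> where lin: "Vector_Spaces.linear scale scale \<sigma>"
    and \<sigma>: "\<forall>m \<in> ?M ` ?C. \<sigma> m = w (inv_into ?C ?M m) *s m"
    using linear_independent_extend[OF ind, of "\<lambda>m. w (inv_into ?C ?M m) *s m"] by blast
  have "\<sigma> (ordered_monomial X a (dim_vec X)) = w a *s ordered_monomial X a (dim_vec X)"
    if a: "a \<in> ?C" for a
  proof -
    obtain c where c: "c \<noteq> 0" "?M a = c *s ordered_monomial X a (dim_vec X)"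
      using qmonomial_eq_scale_ordered_monomial by blast
    have "\<sigma> (?M a) = w a *s ?M a"
      using \<sigma> a inj by simp
    then have "c *s \<sigma> (ordered_monomial X a (dim_vec X))
        = c *s (w a *s ordered_monomial X a (dim_vec X))"
      by (simp add: c linear_scale[OF lin] mult.commute)
    then show ?thesis
      by (rule scale_left_imp_eq[OF c(1)])
  qed
  then show ?thesis
    using lin by blast
qed

text \<open>The construction is carried out for \<open>G\<close> and for \<open>- G\<close>; the two
  extensions are mutually inverse on the torus, hence on all fractions, which gives
  bijectivity.\<close>

lemma diagonal_automorphism:
  assumes ff: "fraction_field_of_qtorus X L" and G: "G \<in> carrier_vec (dim_vec X)"
  shows "\<exists>\<psi>. algebra_iso UNIV UNIV \<psi> \<and>
    (\<forall>i < dim_vec X. \<psi> (X $ i) = (qhalf powi (G $ i)) *s X $ i)"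
proof -
  interpret vector_space_pair scale scale ..
  define n where "n = dim_vec X"
  define P where "P a = ordered_monomial X a n" for a
  define T where "T = span (P ` carrier_vec n)"
  have T: "T = qtorus X L"
    by (simp add: T_def P_def n_def qtorus_eq_span_ordered_monomial)
  have fractions: "\<exists>a \<in> T. \<exists>b \<in> T. b \<noteq> 0 \<and> f = a * inverse b" for f
    using ff unfolding fraction_field_of_qtorus_def T by blast
  have nonzero: "X $ i \<noteq> 0" if "i < n" for i
    using ff that by (simp add: fraction_field_of_qtorus_def n_def)
  have "q powi m \<noteq> 0" for m
    by (simp add: q_def qhalf_nonzero)
  then have qc: "quasi_commute (X $ i) (X $ j)" if "i < n" "j < n" for i j
    using ff that unfolding fraction_field_of_qtorus_def quasi_commute_def n_def by blast
  have P_mult: "\<exists>c. P a * P b = c *s P (a + b)" if "b \<in> carrier_vec n" for a b :: "int vec"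
    unfolding P_def by (rule ordered_monomial_mult) (use nonzero qc that in auto)
  have P_T: "P a \<in> T" if "a \<in> carrier_vec n" for a
    unfolding T_def using that by (blast intro: span_base)
  have P_0: "P (0\<^sub>v n) = 1"
    by (simp add: P_def ordered_monomial_0)
  have one: "1 \<in> T"
    using P_T[of "0\<^sub>v n"] P_0 by simp
  have add: "x + y \<in> T" if "x \<in> T" "y \<in> T" for x y
    using that by (simp add: T_def span_add)
  have scale: "c *s x \<in> T" if "x \<in> T" for c x
    using that by (simp add: T_def span_scale)
  have T_induct: "h x" if "x \<in> T" "h 0"
    "\<And>c a y. a \<in> carrier_vec n \<Longrightarrow> y \<in> T \<Longrightarrow> h y \<Longrightarrow> h (c *s P a + y)" for h x
  proof -
    \<comment> \<open>Strengthening the claim by membership in \<open>T\<close> makes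
      \<open>y \<in> T\<close> available in the induction step.\<close>
    have "x \<in> T \<and> h x"
      using that(1) unfolding T_def
    proof (induction rule: span_induct_alt)
      case base
      show ?case using that(2) by (simp add: span_zero)
    next
      case (step c x y)
      then show ?case
        using that(3) by (auto simp: T_def intro: span_add span_scale span_base)
    qed
    then show ?thesis ..
  qed
  have zero: "0 \<in> T"
    by (simp add: T_def span_zero)
  \<comment> \<open>Closure under products is proved one factor at a time: first with a monomial on
    the left, then with any element of \<open>T\<close>.\<close>
  have mult_P: "P a * y \<in> T" if "a \<in> carrier_vec n" "y \<in> T" for a y
    using that(2)
  proof (rule T_induct)
    fix c and b :: "int vec" and y
    assume *: "b \<in> carrier_vec n" "y \<in> T" "P a * y \<in> T"
    obtain d where "P a * P b = d *s P (a + b)"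
      using P_mult * by blast
    then have "P a * (c *s P b + y) = (c * d) *s P (a + b) + P a * y"
      by (simp add: distrib_left scale_mult_right)
    moreover have "P (a + b) \<in> T"
      using P_T that * by simp
    ultimately show "P a * (c *s P b + y) \<in> T"
      using add scale * by simp
  qed (simp add: zero)
  have mult: "x * y \<in> T" if "x \<in> T" "y \<in> T" for x y
    using that(1)
  proof (rule T_induct)
    fix c and a :: "int vec" and x
    assume *: "a \<in> carrier_vec n" "x \<in> T" "x * y \<in> T"
    then show "(c *s P a + x) * y \<in> T"
      using mult_P[OF *(1) that(2)] by (simp add: distrib_right scale_mult_left add scale)
  qed (simp add: zero)
  \<comment> \<open>The weight \<open>H\<close> is a parameter because both \<open>G\<close> and
    \<open>- G\<close> are needed.\<close>
  define scales where "scales \<sigma> H \<longleftrightarrow> Vector_Spaces.linear scale scale \<sigma> \<and>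
      (\<forall>a \<in> carrier_vec n. \<sigma> (P a) = (qhalf powi (a \<bullet> H)) *s P a)" for \<sigma> H
  have scalesD: "\<sigma> (x + y) = \<sigma> x + \<sigma> y" "\<sigma> (c *s x) = c *s \<sigma> x" "\<sigma> 0 = 0"
    "a \<in> carrier_vec n \<Longrightarrow> \<sigma> (P a) = (qhalf powi (a \<bullet> H)) *s P a"
    if "scales \<sigma> H" for \<sigma> H x y c a
    using that linear_add[of \<sigma>] linear_scale[of \<sigma>] linear_0[of \<sigma>] unfolding scales_def by blast+
  have ex_scales: "\<exists>\<sigma>. scales \<sigma> H" for H
    using linear_scaling_of_monomials[OF ff] unfolding scales_def P_def n_def .
  have scales_T: "\<sigma> x \<in> T" if s: "scales \<sigma> H" and x: "x \<in> T" for \<sigma> H x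
    using x
  proof (rule T_induct)
    show "\<sigma> 0 \<in> T"
      by (simp add: scalesD(3)[OF s] zero)
  next
    fix c and a :: "int vec" and y
    assume *: "a \<in> carrier_vec n" "y \<in> T" "\<sigma> y \<in> T"
    have "\<sigma> (c *s P a + y) = c *s (qhalf powi (a \<bullet> H)) *s P a + \<sigma> y"
      using * by (simp add: scalesD[OF s])
    also have "\<dots> \<in> T"
      using add scale * P_T by simp
    finally show "\<sigma> (c *s P a + y) \<in> T" .
  qed
  have scales_mult: "\<sigma> (x * y) = \<sigma> x * \<sigma> y"
    if s: "scales \<sigma> H" and H: "H \<in> carrier_vec n" and x: "x \<in> T" and y: "y \<in> T" for \<sigma> H x y
  proof -
    note l = scalesD(1-3)[OF s] and \<sigma> = scalesD(4)[OF s]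
    \<comment> \<open>The unknown scalar \<open>c\<close> occurs on both sides, and the weights
      match because \<open>a \<bullet> H\<close> is additive in \<open>a\<close>. Bilinearity then
      extends multiplicativity from monomials to \<open>T\<close>.\<close>
    have P_P: "\<sigma> (P a * P b) = \<sigma> (P a) * \<sigma> (P b)"
      if ab: "a \<in> carrier_vec n" "b \<in> carrier_vec n" for a b
    proof -
      obtain c where c: "P a * P b = c *s P (a + b)"
        using P_mult ab by blast
      have "\<sigma> (P a * P b) = (qhalf powi ((a + b) \<bullet> H)) *s (P a * P b)"
        using ab by (simp add: c l \<sigma> mult.commute)
      also have "qhalf powi ((a + b) \<bullet> H) = qhalf powi (a \<bullet> H) * qhalf powi (b \<bullet> H)"
        using ab H by (simp add: add_scalar_prod_distrib[of _ n] power_int_add qhalf_nonzero)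
      finally show ?thesis
        using ab by (simp add: \<sigma> scale_mult_left scale_mult_right mult.commute)
    qed
    have P_y: "\<sigma> (P a * y) = \<sigma> (P a) * \<sigma> y" if a: "a \<in> carrier_vec n" for a
      using y
    proof (rule T_induct)
      fix c and b :: "int vec" and y
      assume "b \<in> carrier_vec n" "y \<in> T" "\<sigma> (P a * y) = \<sigma> (P a) * \<sigma> y"
      then show "\<sigma> (P a * (c *s P b + y)) = \<sigma> (P a) * \<sigma> (c *s P b + y)"
        using P_P[OF a] by (simp add: distrib_left scale_mult_right l)
    qed (simp add: l)
    show ?thesis
      using x
    proof (rule T_induct)
      fix c and a :: "int vec" and x
      assume "a \<in> carrier_vec n" "x \<in> T" "\<sigma> (x * y) = \<sigma> x * \<sigma> y"
      then show "\<sigma> ((c *s P a + x) * y) = \<sigma> (c *s P a + x) * \<sigma> y"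
        using P_y by (simp add: distrib_right scale_mult_left l)
    qed (simp add: l)
  qed
  have scales_1: "\<sigma> 1 = 1" if "scales \<sigma> H" "H \<in> carrier_vec n" for \<sigma> H
    using scalesD(4)[OF that(1), of "0\<^sub>v n"] that(2) by (simp add: P_0)
  \<comment> \<open>Opposite weights cancel. This gives the trivial kernel on \<open>T\<close>
    required for localisation, and later the inverse automorphism.\<close>
  have scales_uminus: "\<tau> (\<sigma> x) = x"
    if s: "scales \<sigma> H" and t: "scales \<tau> (- H)" and H: "H \<in> carrier_vec n" and x: "x \<in> T" for \<sigma> \<tau> H x
    using x
  proof (rule T_induct)
    show "\<tau> (\<sigma> 0) = 0"
      by (simp add: scalesD(3)[OF s] scalesD(3)[OF t])
  next
    fix c and a :: "int vec" and y
    assume *: "a \<in> carrier_vec n" "\<tau> (\<sigma> y) = y"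
    have "qhalf powi (a \<bullet> H) * qhalf powi (a \<bullet> - H) = 1"
      using * H qhalf_nonzero by (simp flip: power_int_add)
    then show "\<tau> (\<sigma> (c *s P a + y)) = c *s P a + y"
      using * by (simp add: scalesD[OF s] scalesD[OF t] mult.assoc)
  qed
  have ex_hom: "\<exists>\<psi> \<sigma>. scales \<sigma> H \<and> (\<forall>x y. \<psi> (x + y) = \<psi> x + \<psi> y) \<and>
      (\<forall>x y. \<psi> (x * y) = \<psi> x * \<psi> y) \<and> (\<forall>x \<in> T. \<psi> x = \<sigma> x)" if H: "H \<in> carrier_vec n" for H
  proof -
    obtain \<sigma> \<tau> where s: "scales \<sigma> H" and t: "scales \<tau> (- H)"
      using ex_scales by blast
    have "\<tau> 0 = 0"
      by (rule scalesD(3)[OF t])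
    then have "\<sigma> x \<noteq> 0" if "x \<in> T" "x \<noteq> 0" for x
      using scales_uminus[OF s t H that(1)] that(2) by auto
    moreover have "\<sigma> (x + y) = \<sigma> x + \<sigma> y" for x y
      by (rule scalesD(1)[OF s])
    ultimately have "\<exists>\<psi>. (\<forall>x y. \<psi> (x + y) = \<psi> x + \<psi> y) \<and> (\<forall>x y. \<psi> (x * y) = \<psi> x * \<psi> y) \<and>
        (\<forall>x \<in> T. \<psi> x = \<sigma> x)"
      by (intro ring_hom_extends_to_right_fractions add mult one fractions
          scales_mult[OF s H] scales_1[OF s H]) auto
    then show ?thesis
      using s by blast
  qed
  have GT: "G \<in> carrier_vec n"
    using G by (simp add: n_def)
  have GT': "- G \<in> carrier_vec n"
    using GT by simp
  obtain \<psi> \<sigma> where s: "scales \<sigma> G" and \<psi>: "\<And>x y. \<psi> (x + y) = \<psi> x + \<psi> y"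
      "\<And>x y. \<psi> (x * y) = \<psi> x * \<psi> y" "\<And>x. x \<in> T \<Longrightarrow> \<psi> x = \<sigma> x"
    using ex_hom[OF GT] by blast
  obtain \<phi> \<tau> where t: "scales \<tau> (- G)" and \<phi>: "\<And>x y. \<phi> (x + y) = \<phi> x + \<phi> y"
      "\<And>x y. \<phi> (x * y) = \<phi> x * \<phi> y" "\<And>x. x \<in> T \<Longrightarrow> \<phi> x = \<tau> x"
    using ex_hom[OF GT'] by blast
  \<comment> \<open>From \<open>x * b = a\<close> with \<open>a\<close> and \<open>b\<close> fixed
    by \<open>h\<close> follows \<open>h x * b = a\<close>, which determines
    \<open>h x\<close>.\<close>
  have id_if_id_on_T: "h x = x" if "\<And>x y. h (x * y) = h x * h y" "\<And>x. x \<in> T \<Longrightarrow> h x = x" for h x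
  proof -
    obtain a b where ab: "a \<in> T" "b \<in> T" "b \<noteq> 0" "x = a * inverse b"
      using fractions by blast
    have "h x * b = a"
      using that(1)[of x b] that(2)[OF ab(1)] that(2)[OF ab(2)] ab(3,4) by (simp add: mult.assoc)
    then show ?thesis
      using ab(3,4) by (metis mult.assoc mult.right_neutral right_inverse)
  qed
  \<comment> \<open>Since \<open>\<sigma>\<close> maps \<open>T\<close> into itself, the composite
    on \<open>T\<close> is \<open>\<tau>\<close> after \<open>\<sigma>\<close>.\<close>
  have "\<phi> (\<psi> x) = x" for x
    by (rule id_if_id_on_T[of "\<lambda>x. \<phi> (\<psi> x)"])
      (simp_all add: \<psi> \<phi> scales_T[OF s] scales_uminus[OF s t GT])
  moreover have "\<psi> (\<phi> x) = x" for x
  proof (rule id_if_id_on_T[of "\<lambda>x. \<psi> (\<phi> x)"])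
    \<comment> \<open>The cancellation is now used with starting weight \<open>- G\<close>, whose
      opposite must be recognised as the weight of \<open>\<sigma>\<close>.\<close>
    have "scales \<sigma> (- (- G))"
      using s by simp
    then show "\<psi> (\<phi> x) = x" if "x \<in> T" for x
      using that by (simp add: \<psi>(3) \<phi>(3) scales_T[OF t] scales_uminus[OF t _ GT'])
  qed (simp add: \<psi>(2) \<phi>(2))
  ultimately have "bij \<psi>"
    by (intro o_bij[of \<phi>]) auto
  moreover have "\<psi> 1 = 1"
    using \<psi>(3)[OF one] scales_1[OF s GT] by simp
  moreover have "\<psi> (c *s x) = c *s \<psi> x" for c x
  proof -
    \<comment> \<open>Localisation gives only a ring homomorphism. Linearity over the ground field
      follows because scaling by \<open>c\<close> is multiplication by \<open>c *s 1\<close>, an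
      element of \<open>T\<close> fixed by \<open>\<psi>\<close>.\<close>
    have "\<sigma> (c *s 1) = c *s 1"
      by (simp add: scalesD(2)[OF s] scales_1[OF s GT])
    then have "\<psi> (c *s 1) = c *s 1"
      using \<psi>(3) scale one by simp
    then have "\<psi> ((c *s 1) * x) = (c *s 1) * \<psi> x"
      by (simp only: \<psi>(2))
    then show ?thesis
      by (simp add: scale_mult_left)
  qed
  moreover have "\<psi> (X $ i) = (qhalf powi (G $ i)) *s X $ i" if i: "i < n" for i
  proof -
    \<comment> \<open>\<open>X $ i\<close> is the monomial of a unit vector, whose weight is
      \<open>G $ i\<close>.\<close>
    have X: "P (unit_vec n i) = X $ i"
      using i by (simp add: P_def ordered_monomial_unit_vec)
    then show ?thesis
      using scalesD(4)[OF s, of "unit_vec n i"] \<psi>(3)[OF P_T[of "unit_vec n i"]] i GT by (simp add: X)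
  qed
  ultimately show ?thesis
    unfolding algebra_iso_def n_def using \<psi> by blast
qed

section \<open>The twisted seed as the image of the original seed\<close>

lemma twisted_seed_eq_map_seed:
  assumes "graded_quantum_seed r N S"
  shows "\<exists>\<psi>. algebra_iso UNIV UNIV \<psi> \<and> twisted_seed S = map_seed \<psi> S"
proof -
  have "fraction_field_of_qtorus (cluster S) (qcomm S)"
    "grading S \<in> carrier_vec (dim_vec (cluster S))"
    using assms by (auto simp: graded_quantum_seed_def quantum_seed_def)
  then obtain \<psi> where \<psi>: "algebra_iso UNIV UNIV \<psi>"
    "\<forall>i < dim_vec (cluster S). \<psi> (cluster S $ i) = (qhalf powi (grading S $ i)) *s cluster S $ i"
    using diagonal_automorphism by blast
  then have "twisted_seed S = map_seed \<psi> S"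
    unfolding twisted_seed_def map_seed_def
    by (intro arg_cong[where f = "\<lambda>X. S\<lparr>cluster := X\<rparr>"] eq_vecI) auto
  then show ?thesis
    using \<psi>(1) by blast
qed

lemma map_seed_inv_map_seed:
  assumes "inj \<psi>"
  shows "map_seed (inv_into UNIV \<psi>) (map_seed \<psi> S) = S"
proof -
  have "map_vec (inv_into UNIV \<psi>) (map_vec \<psi> X) = X" for X
    by (rule eq_vecI) (simp_all add: inv_f_f[OF assms])
  then show ?thesis
    by (simp add: map_seed_def)
qed

end

theorem proposition3p7:
  fixes scale :: "qfield \<Rightarrow> 'f :: division_ring \<Rightarrow> 'f"
    and r :: nat and N :: "nat set" and S :: "'f graded_seed"
  assumes "skew_field_algebra scale"
    and "skew_field_algebra.graded_quantum_seed scale r N S"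
  shows "skew_field_algebra.graded_quantum_seed scale r N (skew_field_algebra.twisted_seed scale S)
    \<and> (\<exists>\<phi>. skew_field_algebra.graded_qca_iso scale N (skew_field_algebra.twisted_seed scale S) S \<phi>)"
proof -
  interpret skew_field_algebra scale
    by (rule assms(1))
  obtain \<psi> where \<psi>: "algebra_iso UNIV UNIV \<psi>" "twisted_seed S = map_seed \<psi> S"
    using twisted_seed_eq_map_seed[OF assms(2)] by blast
  \<comment> \<open>\<open>\<psi>\<close> leads from \<open>S\<close> to the twisted seed, so the
    isomorphism in the required direction is its inverse.\<close>
  have "map_seed (inv_into UNIV \<psi>) (twisted_seed S) = S"
    using \<psi> algebra_isoD(1)[OF \<psi>(1)] by (simp add: map_seed_inv_map_seed bij_is_inj)
  then have "graded_qca_iso N (twisted_seed S) S (inv_into UNIV \<psi>)"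
    using graded_qca_iso_map_seed[OF algebra_iso_inv[OF \<psi>(1)], of N "twisted_seed S"] by simp
  then show ?thesis
    using graded_quantum_seed_map_seed[OF \<psi>(1) assms(2)] \<psi>(2) by auto
qed

end
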